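(* Let $m$ be a positive integer. We have $$J(2m)=\frac{\pi^2}{48}\left(\frac1m-2m\right)+m\log^2(2)-\sum_{j=0}^{m-1}\log\left(\sin\left(\frac{\pi(2j+1)}{4m}\right)\right)\log\left(\cos\left(\frac{\pi(2j+1)}{4m}\right)\right),$$ and $$J\left(\frac{1}{2m}\right)=\frac{\pi^2}{48}\left(2m-\frac1m\right)+(1-m)\log^2(2)+\sum_{j=0}^{m-1}\log\left(\sin\left(\frac{\pi(2j+1)}{4m}\right)\right)\log\left(\cos\left(\frac{\pi(2j+1)}{4m}\right)\right).$$
   Context: For $\mathrm{Re}(x)>0$, $J(x)=\int_0^1\frac{\log(1+t^x)}{1+t}\,dt$. *)

theory Defs
  imports "HOL-Analysis.Analysis"
begin

(* Intended for Re x > 0.  Both \<open>powr\<close> and \<open>ln\<close> are the principal complex branches.  For Re x > 0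
   and 0 < t < 1 we have |t powr x| < 1, so the branch cut of \<open>ln\<close> is never met; the integrand is
   continuous on [0, 1] (at t = 0, \<open>0 powr x = 0\<close> is the limiting value). *)
definition J :: "complex \<Rightarrow> complex" where
  "J x = integral {0..1::real}
     (\<lambda>t. ln (1 + complex_of_real t powr x) / (1 + complex_of_real t))"

end

theory Submission
  imports Defs "HOL-Computational_Algebra.Polynomial"
begin

text \<open>
  The polynomial \<open>z\<^sup>2\<^sup>m + 1\<close> has the roots \<open>cis (\<plusminus>\<theta>\<^sub>j)\<close> with \<open>\<theta>\<^sub>j = \<pi> (2 j + 1)/(2 m)\<close> for \<open>0 \<le> j < m\<close>.
  Hence \<open>ln (1 + t\<^sup>2\<^sup>m)\<close> is a sum of logarithms of quadratics \<open>1 - 2 t cos \<theta> + t\<^sup>2\<close>, and \<open>J(2 m)\<close> is a sum of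
  values of \<open>I(\<theta>) = \<integral>\<^sub>0\<^sup>1 ln (1 - 2 t cos \<theta> + t\<^sup>2)/(1 + t) dt\<close>.  The function \<open>I\<close> is not elementary: its derivative
  on \<open>(0, \<pi>)\<close> is \<open>tan (\<theta>/2) ln (sin (\<theta>/2)) + (\<pi> - \<theta>)/2\<close>, whose first term integrates to a dilogarithm.
  But the set of the angles \<open>\<theta>\<^sub>j\<close> is symmetric under \<open>\<theta> \<mapsto> \<pi> - \<theta>\<close>, and \<open>I(\<theta>) + I(\<pi> - \<theta>)\<close> is elementary: up to
  a constant it is \<open>\<theta> (\<pi> - \<theta>)/2 - 2 ln (sin (\<theta>/2)) ln (cos (\<theta>/2))\<close> (lemma
  \<open>log_quad_integral_reflection\<close>).

  The constant is read off at \<open>\<theta> = \<pi>/2\<close>, where \<open>I\<close> takes the value \<open>J(2)\<close> (lemma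
  \<open>integral_ln_one_plus_square\<close>).  Only there does a dilogarithm value enter, in the form
  \<open>1 - 1/4 + 1/9 - 1/16 + \<dots> = \<pi>\<^sup>2/12\<close>.

  The value at \<open>1/(2 m)\<close> follows from the relation \<open>J(n) + J(1/n) = (ln 2)\<^sup>2\<close> (lemma \<open>J_reciprocal\<close>): after the
  substitution \<open>t = s\<^sup>n\<close> in \<open>J(1/n)\<close>, the two integrands add up to the derivative of
  \<open>ln (1 + s) ln (1 + s\<^sup>n)\<close>.
\<close>

section \<open>The logarithmic integral of one plus a square\<close>

text \<open>
  This is \<open>-Li\<^sub>2(-y)\<close> for the dilogarithm \<open>Li\<^sub>2\<close>, written as a series that also converges at the end point
  \<open>y = 1\<close>.
\<close>

definition alt_dilog :: "real \<Rightarrow> real" where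
  "alt_dilog y = (\<Sum>n. (-1) ^ n / (real (Suc n))\<^sup>2 * y ^ Suc n)"

text \<open>
  The terms with even \<open>n\<close> add up to a quarter of the full series \<open>\<Sum> 1/n\<^sup>2 = \<pi>\<^sup>2/6\<close>, so reversing their
  signs takes away half of it.
\<close>

lemma alt_dilog_1: "alt_dilog 1 = pi\<^sup>2 / 12"
proof -
  define f where "f = (\<lambda>n. 1 / (real (n + 1))\<^sup>2)"
  have f: "f sums (pi\<^sup>2 / 6)"
    using inverse_squares_sums by (simp add: f_def add_ac)
  have "(\<lambda>k. f k / 4) sums (pi\<^sup>2 / 6 / 4)"
    by (intro sums_divide f)
  hence "(\<lambda>n. if even n then 0 else f ((n - 1) div 2) / 4) sums (pi\<^sup>2 / 6 / 4)"
    by (rule sums_if')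
  from sums_diff[OF f sums_mult[OF this, of 2]]
  have "(\<lambda>n. f n - 2 * (if even n then 0 else f ((n - 1) div 2) / 4)) sums (pi\<^sup>2 / 12)"
    by simp
  also have "(\<lambda>n. f n - 2 * (if even n then 0 else f ((n - 1) div 2) / 4)) =
               (\<lambda>n. (-1) ^ n / (real (Suc n))\<^sup>2 * 1 ^ Suc n)"
  proof
    fix n
    show "f n - 2 * (if even n then 0 else f ((n - 1) div 2) / 4) =
            (-1) ^ n / (real (Suc n))\<^sup>2 * 1 ^ Suc n"
    proof (cases "even n")
      case False
      then obtain k where n: "n = 2 * k + 1" by (elim oddE)
      have "f n = f k / 4"
        using power_mult_distrib[of 2 "real k + 1" 2] by (simp add: f_def n add_ac)
      then show ?thesis by (simp add: n f_def add_ac)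
    qed (simp add: f_def add_ac)
  qed
  finally show ?thesis
    unfolding alt_dilog_def by (rule sums_unique [symmetric])
qed

text \<open>
  Continuity up to the boundary of the disc of convergence, by domination with \<open>\<Sum> 1/n\<^sup>2\<close>; it lets identities
  found by differentiation on the open interval be evaluated at \<open>1\<close>.
\<close>

lemma continuous_on_alt_dilog: "continuous_on {0..1} alt_dilog"
proof -
  have "uniform_limit {0..1} (\<lambda>n y. \<Sum>i<n. (-1) ^ i / (real (Suc i))\<^sup>2 * y ^ Suc i)
          (\<lambda>y. \<Sum>i. (-1) ^ i / (real (Suc i))\<^sup>2 * y ^ Suc i) sequentially"
  proof (rule Weierstrass_m_test)
    show "norm ((-1) ^ n / (real (Suc n))\<^sup>2 * y ^ Suc n) \<le> 1 / (real (n + 1))\<^sup>2"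
      if "y \<in> {0..1}" for n and y :: real
    proof -
      have "y ^ Suc n \<le> 1" using that by (intro power_le_one) auto
      then show ?thesis using that
        by (simp add: abs_mult power_abs divide_simps add_ac del: power_Suc)
    qed
    show "summable (\<lambda>n. 1 / (real (n + 1))\<^sup>2)"
      using inverse_squares_sums by (simp add: sums_iff add_ac)
  qed
  then show ?thesis
    unfolding alt_dilog_def [abs_def]
    by (rule uniform_limit_theorem [rotated]) (auto intro!: always_eventually continuous_intros)
qed

lemma alt_dilog_has_derivative:
  assumes "0 < y" "y < 1"
  shows "(alt_dilog has_real_derivative ln (1 + y) / y) (at y)"
proof -
  define g :: "nat \<Rightarrow> real" where "g = (\<lambda>n. (-1) ^ n / (real (Suc n))\<^sup>2)"
  have g: "g n * real (Suc n) = (-1) ^ n / real (Suc n)" for n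
    by (simp add: g_def power2_eq_square)
  have summ: "summable (\<lambda>n. g n * real (Suc n) * x ^ n)" if "x \<in> {-1<..<1}" for x
  proof (rule summable_comparison_test)
    show "summable (\<lambda>n. \<bar>x\<bar> ^ n)" using that by (intro summable_geometric) auto
    show "\<exists>N. \<forall>n\<ge>N. norm (g n * real (Suc n) * x ^ n) \<le> \<bar>x\<bar> ^ n"
      unfolding g by (intro exI[of _ 0]) (auto simp: abs_mult power_abs divide_simps mult_le_cancel_left1)
  qed
  have "((\<lambda>x. \<Sum>n. g n * x ^ Suc n) has_real_derivative (\<Sum>n. g n * real (Suc n) * y ^ n)) (at y)"
    using assms by (intro DERIV_power_series'[of 1] summ) auto
  moreover have "(\<Sum>n. g n * real (Suc n) * y ^ n) = ln (1 + y) / y"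
  proof -
    have "ln (1 + y) = (\<Sum>n. y * (g n * real (Suc n) * y ^ n))"
      using ln_series[of "1 + y"] assms unfolding g by (simp add: mult_ac)
    also have "\<dots> = y * (\<Sum>n. g n * real (Suc n) * y ^ n)"
      using assms by (intro suminf_mult summ) auto
    finally show ?thesis using assms by simp
  qed
  ultimately show ?thesis by (simp add: alt_dilog_def [abs_def] g_def)
qed

text \<open>
  Introduce a parameter: \<open>K(a) = \<integral>\<^sub>0\<^sup>1 ln (1 + a\<^sup>2 t\<^sup>2)/(1 + t) dt\<close> vanishes at \<open>a = 0\<close>, and its derivative is the
  integral of a rational function.  Partial fractions give that derivative as the sum of
  \<open>2 a ln 2/(1 + a\<^sup>2)\<close>, \<open>ln (1 + a\<^sup>2)/(a (1 + a\<^sup>2))\<close> and \<open>-2 arctan a/(1 + a\<^sup>2)\<close>.  Splitting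
  \<open>1/(a (1 + a\<^sup>2))\<close> into \<open>1/a - a/(1 + a\<^sup>2)\<close> shows that the function \<open>E\<close> below has
  the same derivative for \<open>a > 0\<close>.
\<close>

lemma integral_ln_one_plus_square:
  "integral {0..1} (\<lambda>t::real. ln (1 + t\<^sup>2) / (1 + t)) = 3 / 4 * (ln 2)\<^sup>2 - pi\<^sup>2 / 48"
proof -
  define K :: "real \<Rightarrow> real" where
    "K a = integral {0..1} (\<lambda>t. ln (1 + a\<^sup>2 * t\<^sup>2) / (1 + t))" for a
  define E where "E a = ln 2 * ln (1 + a\<^sup>2) - (arctan a)\<^sup>2
                        + alt_dilog (a\<^sup>2) / 2 - (ln (1 + a\<^sup>2))\<^sup>2 / 4" for a :: real
  have pos: "1 + a\<^sup>2 * t\<^sup>2 > 0" for a t :: real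
    by (simp add: add_pos_nonneg)
  have K': "(K has_real_derivative
              integral {0..1} (\<lambda>t. 2 * a * t\<^sup>2 / ((1 + a\<^sup>2 * t\<^sup>2) * (1 + t)))) (at a)" for a
  proof -
    have "((\<lambda>x. integral (cbox 0 1) (\<lambda>t. ln (1 + x\<^sup>2 * t\<^sup>2) / (1 + t))) has_field_derivative
            integral (cbox 0 1) (\<lambda>t. 2 * a * t\<^sup>2 / ((1 + a\<^sup>2 * t\<^sup>2) * (1 + t)))) (at a within UNIV)"
    proof (rule leibniz_rule_field_derivative)
      show "((\<lambda>x. ln (1 + x\<^sup>2 * t\<^sup>2) / (1 + t)) has_real_derivative
              2 * x * t\<^sup>2 / ((1 + x\<^sup>2 * t\<^sup>2) * (1 + t))) (at x within UNIV)"
        if "t \<in> cbox 0 1" for x t :: real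
        using that pos[of x t] by (auto intro!: derivative_eq_intros simp: divide_simps)
      show "(\<lambda>t. ln (1 + x\<^sup>2 * t\<^sup>2) / (1 + t)) integrable_on cbox 0 1" for x :: real
        using pos[of x] by (intro integrable_continuous continuous_intros) (auto simp: less_imp_neq[symmetric])
      show "continuous_on (UNIV \<times> cbox 0 1)
              (\<lambda>(x, t). 2 * x * t\<^sup>2 / ((1 + x\<^sup>2 * t\<^sup>2) * (1 + t)) :: real)"
        using pos by (auto intro!: continuous_intros simp: split_beta less_imp_neq[symmetric])
    qed auto
    then show ?thesis by (simp add: K_def [abs_def])
  qed
  have int: "integral {0..1} (\<lambda>t. 2 * a * t\<^sup>2 / ((1 + a\<^sup>2 * t\<^sup>2) * (1 + t))) =
               2 * a / (1 + a\<^sup>2) * (ln 2 + ln (1 + a\<^sup>2) / (2 * a\<^sup>2) - arctan a / a)"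
    if "a > 0" for a
  proof -
    define P where "P t = 2 * a / (1 + a\<^sup>2) *
      (ln (1 + t) + ln (1 + a\<^sup>2 * t\<^sup>2) / (2 * a\<^sup>2) - arctan (a * t) / a)" for t
    have "((\<lambda>t. 2 * a * t\<^sup>2 / ((1 + a\<^sup>2 * t\<^sup>2) * (1 + t))) has_integral P 1 - P 0) {0..1}"
    proof (rule fundamental_theorem_of_calculus)
      fix t :: real assume t: "t \<in> {0..1}"
      have nz: "1 + t \<noteq> 0" "1 + a\<^sup>2 * t\<^sup>2 \<noteq> 0" "1 + a\<^sup>2 \<noteq> 0"
        using t pos[of a t] pos[of a 1] by auto
      have D1: "((\<lambda>t. ln (1 + t)) has_real_derivative 1 / (1 + t)) (at t)"
        using t by (auto intro!: derivative_eq_intros)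
      have D2: "((\<lambda>t. ln (1 + a\<^sup>2 * t\<^sup>2)) has_real_derivative 2 * a\<^sup>2 * t / (1 + a\<^sup>2 * t\<^sup>2)) (at t)"
        using pos[of a t] by (auto intro!: derivative_eq_intros)
      have D3: "((\<lambda>t. arctan (a * t)) has_real_derivative a / (1 + (a * t)\<^sup>2)) (at t)"
        by (auto intro!: derivative_eq_intros simp: divide_inverse)
      have "(P has_real_derivative 2 * a / (1 + a\<^sup>2) *
        (1 / (1 + t) + (2 * a\<^sup>2 * t / (1 + a\<^sup>2 * t\<^sup>2)) / (2 * a\<^sup>2) - (a / (1 + (a * t)\<^sup>2)) / a)) (at t)"
        unfolding P_def [abs_def]
        by (intro DERIV_cmult DERIV_diff DERIV_add DERIV_cdivide D1 D2 D3)
      also have "2 * a / (1 + a\<^sup>2) *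
        (1 / (1 + t) + (2 * a\<^sup>2 * t / (1 + a\<^sup>2 * t\<^sup>2)) / (2 * a\<^sup>2) - (a / (1 + (a * t)\<^sup>2)) / a) =
        2 * a / (1 + a\<^sup>2) * (1 / (1 + t) + (t - 1) / (1 + a\<^sup>2 * t\<^sup>2))"
        using that nz by (simp add: power_mult_distrib diff_divide_distrib)
      also have "1 / (1 + t) + (t - 1) / (1 + a\<^sup>2 * t\<^sup>2) =
                   t\<^sup>2 * (1 + a\<^sup>2) / ((1 + a\<^sup>2 * t\<^sup>2) * (1 + t))"
        using nz by (simp add: divide_simps) (simp add: algebra_simps power2_eq_square)
      also have "2 * a / (1 + a\<^sup>2) * \<dots> = 2 * a * t\<^sup>2 / ((1 + a\<^sup>2 * t\<^sup>2) * (1 + t))"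
        using nz by simp
      finally show "(P has_vector_derivative 2 * a * t\<^sup>2 / ((1 + a\<^sup>2 * t\<^sup>2) * (1 + t)))
                      (at t within {0..1})"
        by (simp add: has_real_derivative_iff_has_vector_derivative has_vector_derivative_at_within)
    qed simp
    then show ?thesis by (simp add: integral_unique P_def)
  qed
  have "K 1 - E 1 = K 0 - E 0"
  proof (rule DERIV_isconst_end[of 0 1 "\<lambda>a. K a - E a"])
    show "continuous_on {0..1} (\<lambda>a. K a - E a)"
    proof (intro continuous_on_diff)
      show "continuous_on {0..1} K"
        by (rule DERIV_continuous_on, rule has_field_derivative_at_within, rule K')
      show "continuous_on {0..1} E"
        unfolding E_def [abs_def]
        by (intro continuous_intros continuous_on_compose2[OF continuous_on_alt_dilog])
           (auto simp: power_le_one add_nonneg_eq_0_iff)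
    qed
    show "((\<lambda>a. K a - E a) has_real_derivative 0) (at a)" if a: "0 < a" "a < 1" for a
    proof -
      have nz: "1 + a\<^sup>2 > 0" using pos[of a 1] by simp
      have a2: "0 < a\<^sup>2" "a\<^sup>2 < 1" using a by (auto simp: power_less_one_iff)
      have D1: "((\<lambda>a. alt_dilog (a\<^sup>2)) has_real_derivative ln (1 + a\<^sup>2) / a\<^sup>2 * (2 * a)) (at a)"
        by (rule DERIV_chain2[where g = "\<lambda>a. a\<^sup>2", OF alt_dilog_has_derivative[OF a2]]) (auto intro!: derivative_eq_intros)
      have D2: "((\<lambda>a. ln (1 + a\<^sup>2)) has_real_derivative 2 * a / (1 + a\<^sup>2)) (at a)"
        using nz by (auto intro!: derivative_eq_intros)
      have D3: "((\<lambda>a. (ln (1 + a\<^sup>2))\<^sup>2) has_real_derivative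
                  2 * ln (1 + a\<^sup>2) * (2 * a / (1 + a\<^sup>2))) (at a)"
        using DERIV_power[OF D2, of 2] by (simp add: mult_ac)
      have D4: "((\<lambda>a. (arctan a)\<^sup>2) has_real_derivative 2 * arctan a / (1 + a\<^sup>2)) (at a)"
        by (auto intro!: derivative_eq_intros simp: divide_inverse)
      have "(E has_real_derivative ln 2 * (2 * a / (1 + a\<^sup>2)) - 2 * arctan a / (1 + a\<^sup>2)
              + ln (1 + a\<^sup>2) / a\<^sup>2 * (2 * a) / 2 - 2 * ln (1 + a\<^sup>2) * (2 * a / (1 + a\<^sup>2)) / 4) (at a)"
        unfolding E_def [abs_def]
        by (intro DERIV_diff DERIV_add DERIV_cmult DERIV_cdivide D1 D2 D3 D4)
      moreover have "ln 2 * (2 * a / (1 + a\<^sup>2)) - 2 * arctan a / (1 + a\<^sup>2)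
              + ln (1 + a\<^sup>2) / a\<^sup>2 * (2 * a) / 2 - 2 * ln (1 + a\<^sup>2) * (2 * a / (1 + a\<^sup>2)) / 4 =
            2 * a / (1 + a\<^sup>2) * (ln 2 + ln (1 + a\<^sup>2) / (2 * a\<^sup>2) - arctan a / a)"
        using a nz by (simp add: divide_simps) (simp add: algebra_simps power2_eq_square)
      ultimately show ?thesis
        using DERIV_diff[OF K'[of a]] int[OF a(1)] by fastforce
    qed
  qed simp
  moreover have "K 0 = 0" "E 0 = 0" by (simp_all add: K_def E_def alt_dilog_def)
  moreover have "E 1 = 3 / 4 * (ln 2)\<^sup>2 - pi\<^sup>2 / 48"
    by (simp add: E_def alt_dilog_1 arctan_one power2_eq_square field_simps)
  ultimately show ?thesis by (simp add: K_def)
qed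

section \<open>Logarithmic integrals of quadratics with unimodular roots\<close>

definition log_quad_integral :: "real \<Rightarrow> real" where
  "log_quad_integral \<theta> = integral {0..1} (\<lambda>t. ln (1 - 2 * t * cos \<theta> + t\<^sup>2) / (1 + t))"

text \<open>
  The quadratic is the squared distance of \<open>t\<close> from the point of the unit circle at angle \<open>\<theta>\<close>, and that point is not
  real.
\<close>

lemma quad_pos:
  fixes t \<theta> :: real
  assumes "sin \<theta> \<noteq> 0"
  shows "1 - 2 * t * cos \<theta> + t\<^sup>2 > 0"
proof -
  have "1 - 2 * t * cos \<theta> + t\<^sup>2 = (t - cos \<theta>)\<^sup>2 + (sin \<theta>)\<^sup>2"
    by (simp add: sin_squared_eq power2_eq_square algebra_simps)
  then show ?thesis using assms by (simp add: add_nonneg_pos)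
qed

lemma integrable_log_quad:
  fixes \<theta> :: real
  assumes "sin \<theta> \<noteq> 0"
  shows "(\<lambda>t. ln (1 - 2 * t * cos \<theta> + t\<^sup>2) / (1 + t)) integrable_on {0..1}"
  using quad_pos[OF assms]
  by (intro integrable_continuous_real continuous_intros) (auto simp: less_imp_neq[symmetric])

lemma log_quad_integral_has_derivative_integral:
  assumes "0 < \<theta>" "\<theta> < pi"
  shows "(log_quad_integral has_real_derivative
           integral {0..1} (\<lambda>t. 2 * t * sin \<theta> / ((1 - 2 * t * cos \<theta> + t\<^sup>2) * (1 + t)))) (at \<theta>)"
proof -
  have sin: "sin x \<noteq> 0" if "x \<in> {0<..<pi}" for x :: real
    using sin_gt_zero[of x] that by auto
  have "((\<lambda>x. integral (cbox 0 1) (\<lambda>t. ln (1 - 2 * t * cos x + t\<^sup>2) / (1 + t))) has_field_derivative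
          integral (cbox 0 1) (\<lambda>t. 2 * t * sin \<theta> / ((1 - 2 * t * cos \<theta> + t\<^sup>2) * (1 + t))))
          (at \<theta> within {0<..<pi})"
  proof (rule leibniz_rule_field_derivative)
    show "((\<lambda>x. ln (1 - 2 * t * cos x + t\<^sup>2) / (1 + t)) has_real_derivative
            2 * t * sin x / ((1 - 2 * t * cos x + t\<^sup>2) * (1 + t))) (at x within {0<..<pi})"
      if "t \<in> cbox 0 1" "x \<in> {0<..<pi}" for x t :: real
      using that quad_pos[OF sin, of x t] 
      by (auto intro!: derivative_eq_intros simp: divide_simps)
    show "(\<lambda>t. ln (1 - 2 * t * cos x + t\<^sup>2) / (1 + t)) integrable_on cbox 0 1"
      if "x \<in> {0<..<pi}" for x
      using integrable_log_quad[OF sin[OF that]] by simp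
    show "continuous_on ({0<..<pi} \<times> cbox 0 1)
            (\<lambda>(x, t). 2 * t * sin x / ((1 - 2 * t * cos x + t\<^sup>2) * (1 + t)) :: real)"
      unfolding split_beta
    proof (intro continuous_intros ballI)
      fix p :: "real \<times> real" assume "p \<in> {0<..<pi} \<times> cbox 0 1"
      then show "(1 - 2 * snd p * cos (fst p) + (snd p)\<^sup>2) * (1 + snd p) \<noteq> 0"
        using quad_pos[OF sin, of "fst p" "snd p"] by auto
    qed
  qed (use assms in auto)
  moreover have "at \<theta> within {0<..<pi} = at \<theta>"
    using assms by (intro at_within_open) auto
  ultimately show ?thesis by (simp add: log_quad_integral_def [abs_def])
qed

text \<open>
  Partial fractions give the antiderivative
  \<open>tan (\<theta>/2) (ln (1 - 2 t cos \<theta> + t\<^sup>2)/2 - ln (1 + t)) + arctan ((t - cos \<theta>)/sin \<theta>)\<close>.  At the end points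
  the arctangents are the angles \<open>\<theta>/2\<close> and \<open>\<theta> - \<pi>/2\<close>, and \<open>2 - 2 cos \<theta> = (2 sin (\<theta>/2))\<^sup>2\<close> makes the
  logarithm of \<open>2\<close> cancel.
\<close>

lemma integral_log_quad_derivative:
  assumes "0 < \<theta>" "\<theta> < pi"
  shows "integral {0..1} (\<lambda>t. 2 * t * sin \<theta> / ((1 - 2 * t * cos \<theta> + t\<^sup>2) * (1 + t))) =
           tan (\<theta> / 2) * ln (sin (\<theta> / 2)) + (pi - \<theta>) / 2"
proof -
  define u where "u = \<theta> / 2"
  have u: "0 < u" "u < pi / 2" and \<theta>: "\<theta> = 2 * u"
    using assms by (auto simp: u_def)
  define s c where "s = sin \<theta>" and "c = cos \<theta>"
  have su: "sin u > 0" and cu: "cos u > 0"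
    using u by (auto intro: sin_gt_zero cos_gt_zero)
  have s: "s > 0" using assms by (auto simp: s_def intro: sin_gt_zero)
  have sc: "s\<^sup>2 + c\<^sup>2 = 1" by (simp add: s_def c_def)
  have dbl: "s = 2 * sin u * cos u" "1 + c = 2 * (cos u)\<^sup>2" "1 - c = 2 * (sin u)\<^sup>2"
    using cos_double_cos[of u] cos_double_sin[of u] by (simp_all add: s_def c_def \<theta> sin_double)
  have tan: "tan u = s / (1 + c)" "tan u = (1 - c) / s"
    using su cu by (simp_all add: dbl tan_def power2_eq_square)
  have c1: "1 + c > 0" using cu by (simp add: dbl)
  have q: "1 - 2 * t * c + t\<^sup>2 > 0" for t
    using quad_pos[of \<theta> t] s by (simp add: s_def c_def)
  have q2: "1 - 2 * t * c + t\<^sup>2 = s\<^sup>2 + (t - c)\<^sup>2" for t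
    using sc by (simp add: power2_eq_square algebra_simps)
  define P where "P t = tan u * (ln (1 - 2 * t * c + t\<^sup>2) / 2 - ln (1 + t)) + arctan ((t - c) / s)" for t
  have "((\<lambda>t. 2 * t * s / ((1 - 2 * t * c + t\<^sup>2) * (1 + t))) has_integral P 1 - P 0) {0..1}"
  proof (rule fundamental_theorem_of_calculus)
    fix t :: real assume t: "t \<in> {0..1}"
    define Q where "Q = 1 - 2 * t * c + t\<^sup>2"
    have Q: "Q > 0" using q[of t] by (simp add: Q_def)
    have D1: "((\<lambda>t. ln (1 - 2 * t * c + t\<^sup>2)) has_real_derivative (2 * t - 2 * c) / Q) (at t)"
      using q[of t] by (auto intro!: derivative_eq_intros simp: Q_def)
    have D2: "((\<lambda>t. ln (1 + t)) has_real_derivative 1 / (1 + t)) (at t)"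
      using t by (auto intro!: derivative_eq_intros)
    have D3: "((\<lambda>t. arctan ((t - c) / s)) has_real_derivative
                1 / s * inverse (1 + ((t - c) / s)\<^sup>2)) (at t)"
      using s by (auto intro!: derivative_eq_intros)
    have "(P has_real_derivative tan u * ((2 * t - 2 * c) / Q / 2 - 1 / (1 + t))
             + (1 / s) / (1 + ((t - c) / s)\<^sup>2)) (at t)"
      using DERIV_add[OF DERIV_cmult[OF DERIV_diff[OF DERIV_cdivide[OF D1] D2]] D3]
      unfolding P_def [abs_def] by (simp only: divide_inverse)
    also have "(1 / s) / (1 + ((t - c) / s)\<^sup>2) = s / Q"
    proof -
      have "1 + ((t - c) / s)\<^sup>2 = Q / s\<^sup>2"
        using s by (simp add: Q_def q2 power_divide add_divide_distrib)
      then show ?thesis using s by (simp add: power2_eq_square)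
    qed
    also have "tan u * ((2 * t - 2 * c) / Q / 2 - 1 / (1 + t)) + s / Q =
                 s / (1 + c) * ((t - c) * (1 + t) - Q + (1 + c) * (1 + t)) / (Q * (1 + t))"
      unfolding tan using c1 Q t by (simp add: divide_simps) (simp add: algebra_simps)
    also have "(t - c) * (1 + t) - Q + (1 + c) * (1 + t) = 2 * t * (1 + c)"
      by (simp add: Q_def power2_eq_square algebra_simps)
    also have "s / (1 + c) * (2 * t * (1 + c)) / (Q * (1 + t)) = 2 * t * s / (Q * (1 + t))"
      using c1 by simp
    finally show "(P has_vector_derivative 2 * t * s / ((1 - 2 * t * c + t\<^sup>2) * (1 + t)))
                    (at t within {0..1})"
      by (simp add: Q_def has_real_derivative_iff_has_vector_derivative has_vector_derivative_at_within)
  qed simp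
  moreover have "P 1 - P 0 = tan u * ln (sin u) + (pi / 2 - u)"
  proof -
    have "1 - 2 * 1 * c + 1\<^sup>2 = (2 * sin u)\<^sup>2"
      using dbl(3) by (simp add: power_mult_distrib)
    then have "ln (1 - 2 * 1 * c + 1\<^sup>2) = ln ((2 * sin u)\<^sup>2)"
      by (simp only:)
    also have "\<dots> = 2 * ln (2 * sin u)"
      using su ln_realpow[of "2 * sin u" 2] by simp
    also have "\<dots> = 2 * (ln 2 + ln (sin u))"
      using su by (simp add: ln_mult)
    finally have 1: "ln (1 - 2 * 1 * c + 1\<^sup>2) = 2 * (ln 2 + ln (sin u))" .
    have 2: "arctan ((1 - c) / s) = u"
      using u tan(2) by (simp add: arctan_unique)
    have "tan (pi / 2 - 2 * u) = c / s"
      by (simp add: tan_def s_def c_def \<theta> sin_diff cos_diff)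
    then have "arctan (c / s) = pi / 2 - 2 * u"
      using u by (intro arctan_unique) auto
    then have 3: "arctan ((0 - c) / s) = 2 * u - pi / 2"
      by (simp add: arctan_minus)
    show ?thesis unfolding P_def 1 2 3 by (simp add: algebra_simps)
  qed
  ultimately show ?thesis by (simp add: integral_unique s_def c_def u_def diff_divide_distrib)
qed

lemma log_quad_integral_has_derivative:
  assumes "0 < \<theta>" "\<theta> < pi"
  shows "(log_quad_integral has_real_derivative
           tan (\<theta> / 2) * ln (sin (\<theta> / 2)) + (pi - \<theta>) / 2) (at \<theta>)"
  using log_quad_integral_has_derivative_integral[OF assms] integral_log_quad_derivative[OF assms] by simp

text \<open>
  With \<open>u = \<theta>/2\<close>, the derivative of \<open>log_quad_integral\<close> contributes \<open>tan u ln (sin u)\<close> and its mirror image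
  contributes \<open>- cot u ln (cos u)\<close>.  Neither has an elementary antiderivative, but their sum is the derivative of
  \<open>-2 ln (sin u) ln (cos u)\<close> with respect to \<open>\<theta>\<close>.
\<close>

lemma log_quad_integral_reflection:
  assumes "0 < \<theta>" "\<theta> < pi"
  shows "log_quad_integral \<theta> + log_quad_integral (pi - \<theta>) =
           \<theta> * (pi - \<theta>) / 2 - 2 * ln (sin (\<theta> / 2)) * ln (cos (\<theta> / 2)) + 2 * (ln 2)\<^sup>2 - pi\<^sup>2 / 6"
proof -
  define D where "D x = log_quad_integral x + log_quad_integral (pi - x)
      - (x * (pi - x) / 2 - 2 * ln (sin (x / 2)) * ln (cos (x / 2)))" for x
  have "D \<theta> = D (pi / 2)"
  proof (rule DERIV_isconst3[of 0 pi \<theta> "pi / 2" D])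
    fix x :: real assume "x \<in> {0<..<pi}"
    then have x: "0 < x" "x < pi" by auto
    have sc: "sin (x / 2) > 0" "cos (x / 2) > 0"
      using x by (auto intro: sin_gt_zero cos_gt_zero)
    have "((\<lambda>x. log_quad_integral (pi - x)) has_real_derivative
            (tan ((pi - x) / 2) * ln (sin ((pi - x) / 2)) + (pi - (pi - x)) / 2) * (-1)) (at x)"
      by (rule DERIV_chain2[OF log_quad_integral_has_derivative])
         (use x in \<open>auto intro!: derivative_eq_intros\<close>)
    moreover have "sin ((pi - x) / 2) = cos (x / 2)" "cos ((pi - x) / 2) = sin (x / 2)"
      by (simp_all add: diff_divide_distrib sin_diff cos_diff)
    ultimately have refl: "((\<lambda>x. log_quad_integral (pi - x)) has_real_derivative
            - (cos (x / 2) / sin (x / 2) * ln (cos (x / 2)) + x / 2)) (at x)"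
      by (simp add: tan_def)
    have "((\<lambda>x. x * (pi - x) / 2 - 2 * ln (sin (x / 2)) * ln (cos (x / 2))) has_real_derivative
            (pi - x) / 2 - x / 2 - (cos (x / 2) / sin (x / 2) * ln (cos (x / 2))
               - ln (sin (x / 2)) * (sin (x / 2) / cos (x / 2)))) (at x)"
      using sc by (auto intro!: derivative_eq_intros simp: field_simps)
    from DERIV_diff[OF DERIV_add[OF log_quad_integral_has_derivative[OF x] refl] this]
    show "(D has_real_derivative 0) (at x)"
      unfolding D_def [abs_def] by (simp add: tan_def mult.commute)
  qed (use assms in auto)
  moreover have "D (pi / 2) = 2 * (ln 2)\<^sup>2 - pi\<^sup>2 / 6"
  proof -
    \<comment> \<open>At the fixed point of the reflection the quadratic is \<open>1 + t\<^sup>2\<close>.\<close>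
    have L: "ln (sqrt 2 / 2) = - ln 2 / (2::real)"
      by (simp add: ln_div ln_sqrt)
    have I: "log_quad_integral (pi / 2) = 3 / 4 * (ln 2)\<^sup>2 - pi\<^sup>2 / 48"
      using integral_ln_one_plus_square by (simp add: log_quad_integral_def)
    have "pi - pi / 2 = pi / 2" "pi / 2 / 2 = pi / 4" by simp_all
    then show ?thesis
      unfolding D_def by (simp only: sin_45 cos_45 L I) (simp add: power2_eq_square field_simps)
  qed
  ultimately show ?thesis by (simp add: D_def)
qed

section \<open>Factorisation of one plus an even power\<close>

text \<open>
  The numbers in question are \<open>n\<close> different roots of the monic polynomial \<open>X\<^sup>n + 1\<close>: they are the \<open>n\<close>-th roots of
  unity, all multiplied by the one root \<open>cis (pi / n)\<close> of \<open>-1\<close>.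
\<close>

lemma prod_linear_roots_of_minus_one:
  fixes z :: complex
  assumes "n > 0"
  shows "(\<Prod>j<n. z - cis (pi * (2 * real j + 1) / real n)) = z ^ n + 1"
proof -
  define r where "r j = cis (pi * (2 * real j + 1) / real n)" for j
  have r_pow: "r j ^ n = -1" for j
  proof -
    have "real n * (pi * (2 * real j + 1) / real n) = 2 * pi * real j + pi"
      using assms by (simp add: field_simps)
    then have "r j ^ n = cis (2 * pi * real j + pi)"
      by (simp only: r_def Complex.DeMoivre)
    also have "\<dots> = cis (2 * pi * real j) * cis pi" by (simp only: cis_mult)
    finally show ?thesis by (simp add: cis_multiple_2pi)
  qed
  have inj: "inj_on r {..<n}"
  proof (rule inj_onI)
    fix i j assume ij: "i \<in> {..<n}" "j \<in> {..<n}" and eq: "r i = r j"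
    have "cis (2 * pi * real k / real n) = r k / cis (pi / real n)" for k
      by (simp add: r_def cis_divide) (simp add: diff_divide_distrib add_divide_distrib algebra_simps)
    then have "cis (2 * pi * real i / real n) = cis (2 * pi * real j / real n)"
      using eq by simp
    then show "i = j"
      using Complex.bij_betw_roots_unity[OF assms] ij by (auto simp: bij_betw_def dest: inj_onD)
  qed
  have "(\<Prod>j<n. [:- r j, 1:]) = monom 1 n + 1"
  proof (rule poly_eqI_degree_lead_coeff)
    have deg: "degree (\<Prod>j<n. [:- r j, 1:]) = n"
      by (subst degree_prod_eq_sum_degree) auto
    have "lead_coeff (\<Prod>j<n. [:- r j, 1:]) = 1"
      by (simp add: lead_coeff_prod)
    then show "coeff (\<Prod>j<n. [:- r j, 1:]) n = coeff (monom 1 n + 1) n"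
      using deg assms by simp
    show "degree (\<Prod>j<n. [:- r j, 1:]) \<le> n" using deg by simp
    show "degree (monom 1 n + 1 :: complex poly) \<le> n"
      by (intro degree_add_le degree_monom_le) auto
    show "n \<le> card (r ` {..<n})" using inj by (simp add: card_image)
    show "poly (\<Prod>j<n. [:- r j, 1:]) w = poly (monom 1 n + 1) w" if "w \<in> r ` {..<n}" for w
      using that r_pow by (auto simp: poly_prod poly_monom prod_zero_iff)
  qed
  from arg_cong[OF this, of "\<lambda>p. poly p z"] show ?thesis
    by (simp add: poly_prod poly_monom r_def)
qed

text \<open>
  The squared modulus of the factorisation of \<open>t\<^sup>2\<^sup>m + 1\<close> into linear factors.  Increasing the index by \<open>m\<close> turns a
  root into its negative, so the \<open>2 m\<close> squared distances pair up.  Working with the square of \<open>1 + t\<^sup>2\<^sup>m\<close> puts the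
  quadratics of the angles \<open>\<theta>\<close> and \<open>\<pi> - \<theta>\<close> side by side, as the reflection formula needs them.
\<close>

lemma prod_quadratics_power_plus_one:
  fixes t :: real
  assumes "m > 0"
  shows "(\<Prod>j<m. (1 - 2 * t * cos (pi * (2 * real j + 1) / (2 * real m)) + t\<^sup>2) *
                  (1 + 2 * t * cos (pi * (2 * real j + 1) / (2 * real m)) + t\<^sup>2)) = (1 + t ^ (2 * m))\<^sup>2"
proof -
  define \<theta> where "\<theta> j = pi * (2 * real j + 1) / (2 * real m)" for j
  have norm2: "(cmod (of_real t - cis x))\<^sup>2 = 1 - 2 * t * cos x + t\<^sup>2" for x
  proof -
    have "(cmod (of_real t - cis x))\<^sup>2 = (t - cos x)\<^sup>2 + (sin x)\<^sup>2"
      by (simp add: cmod_power2)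
    then show ?thesis
      by (simp add: sin_squared_eq power2_eq_square algebra_simps)
  qed
  have shift: "cos (\<theta> (m + j)) = - cos (\<theta> j)" for j
  proof -
    have "\<theta> (m + j) = \<theta> j + pi"
      using assms by (simp add: \<theta>_def field_simps)
    then show ?thesis by simp
  qed
  have split: "(\<Prod>j<m + k. f j) = (\<Prod>j<m. f j) * (\<Prod>j<k. f (m + j))" for f :: "nat \<Rightarrow> real" and k
    by (induction k) (simp_all add: mult.assoc)
  have "(cmod (of_real t ^ (2 * m) + 1))\<^sup>2 = (\<Prod>j<m + m. (cmod (of_real t - cis (\<theta> j)))\<^sup>2)"
  proof -
    have "of_real t ^ (2 * m) + 1 = (\<Prod>j<m + m. of_real t - cis (\<theta> j))"
      using prod_linear_roots_of_minus_one[of "m + m" "of_real t"] assms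
      by (simp add: \<theta>_def flip: mult_2)
    then show ?thesis by (simp only: prod_norm [symmetric] prod_power_distrib)
  qed
  also have "\<dots> = (\<Prod>j<m + m. 1 - 2 * t * cos (\<theta> j) + t\<^sup>2)"
    by (simp add: norm2)
  also have "\<dots> = (\<Prod>j<m. 1 - 2 * t * cos (\<theta> j) + t\<^sup>2) * (\<Prod>j<m. 1 - 2 * t * cos (\<theta> (m + j)) + t\<^sup>2)"
    by (rule split)
  also have "\<dots> = (\<Prod>j<m. (1 - 2 * t * cos (\<theta> j) + t\<^sup>2) * (1 + 2 * t * cos (\<theta> j) + t\<^sup>2))"
    by (simp add: shift prod.distrib)
  also have "(cmod (of_real t ^ (2 * m) + 1))\<^sup>2 = (1 + t ^ (2 * m))\<^sup>2"
  proof -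
    have "complex_of_real t ^ (2 * m) + 1 = of_real (1 + t ^ (2 * m))" by simp
    then show ?thesis by (simp only: norm_of_real power2_abs)
  qed
  finally show ?thesis by (simp add: \<theta>_def)
qed

section \<open>Real integrals for even exponents\<close>

lemma odd_multiple_angle_bounds:
  assumes "j < m"
  shows "0 < pi * (2 * real j + 1) / (2 * real m)" "pi * (2 * real j + 1) / (2 * real m) < pi"
proof -
  have "2 * real j + 1 < 2 * real m" using assms by linarith
  then show "pi * (2 * real j + 1) / (2 * real m) < pi"
    using assms by (simp add: divide_simps)
  show "0 < pi * (2 * real j + 1) / (2 * real m)"
    using assms by (simp add: add_nonneg_pos)
qed

text \<open>
  The second factor \<open>1 + 2 t cos \<theta> + t\<^sup>2\<close> in the factorisation is the quadratic that belongs to \<open>\<pi> - \<theta>\<close>.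
\<close>

lemma twice_integral_as_log_quad_sum:
  assumes "m > 0"
  shows "2 * integral {0..1} (\<lambda>t::real. ln (1 + t ^ (2 * m)) / (1 + t)) =
           (\<Sum>j<m. log_quad_integral (pi * (2 * real j + 1) / (2 * real m))
                 + log_quad_integral (pi - pi * (2 * real j + 1) / (2 * real m)))"
proof -
  define \<theta> where "\<theta> j = pi * (2 * real j + 1) / (2 * real m)" for j
  let ?L = "\<lambda>x t. ln (1 - 2 * t * cos x + t\<^sup>2) / (1 + t)"
  have sin: "sin (\<theta> j) \<noteq> 0" if "j < m" for j
    using sin_gt_zero[OF odd_multiple_angle_bounds[OF that]] by (simp add: \<theta>_def)
  have split: "2 * (ln (1 + t ^ (2 * m)) / (1 + t)) = (\<Sum>j<m. ?L (\<theta> j) t + ?L (pi - \<theta> j) t)" for t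
  proof -
    have pos: "1 - 2 * t * cos (\<theta> j) + t\<^sup>2 > 0" "1 + 2 * t * cos (\<theta> j) + t\<^sup>2 > 0" if "j < m" for j
      using quad_pos[OF sin[OF that], of t] quad_pos[OF sin[OF that], of "- t"] by simp_all
    have ne: "(1 - 2 * t * cos (\<theta> j) + t\<^sup>2) * (1 + 2 * t * cos (\<theta> j) + t\<^sup>2) \<noteq> 0" if "j < m" for j
      using mult_pos_pos[OF pos[OF that]] by (rule less_imp_neq[symmetric])
    have "1 + t ^ (2 * m) > 0"
      by (simp add: add_pos_nonneg power_mult)
    then have "2 * ln (1 + t ^ (2 * m)) = ln ((1 + t ^ (2 * m))\<^sup>2)"
      using ln_realpow[of "1 + t ^ (2 * m)" 2] by simp
    also have "\<dots> = (\<Sum>j<m. ln ((1 - 2 * t * cos (\<theta> j) + t\<^sup>2) * (1 + 2 * t * cos (\<theta> j) + t\<^sup>2)))"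
      unfolding prod_quadratics_power_plus_one[OF assms, of t, folded \<theta>_def, symmetric]
      by (rule ln_prod) (use ne in blast)+
    also have "\<dots> = (\<Sum>j<m. ln (1 - 2 * t * cos (\<theta> j) + t\<^sup>2) + ln (1 + 2 * t * cos (\<theta> j) + t\<^sup>2))"
      using pos by (intro sum.cong refl ln_mult_pos) auto
    finally have "2 * (ln (1 + t ^ (2 * m)) / (1 + t)) =
        (\<Sum>j<m. ln (1 - 2 * t * cos (\<theta> j) + t\<^sup>2) + ln (1 + 2 * t * cos (\<theta> j) + t\<^sup>2)) / (1 + t)"
      by (simp only: times_divide_eq_right)
    then show ?thesis
      by (simp add: sum_divide_distrib add_divide_distrib)
  qed
  have int: "?L (\<theta> j) integrable_on {0..1}" "?L (pi - \<theta> j) integrable_on {0..1}" if "j < m" for j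
    using sin[OF that] integrable_log_quad[of "\<theta> j"] integrable_log_quad[of "pi - \<theta> j"] by simp_all
  have "2 * integral {0..1} (\<lambda>t::real. ln (1 + t ^ (2 * m)) / (1 + t)) =
          integral {0..1} (\<lambda>t. \<Sum>j<m. ?L (\<theta> j) t + ?L (pi - \<theta> j) t)"
    unfolding split [symmetric] by (rule integral_mult_right [symmetric])
  also have "\<dots> = (\<Sum>j<m. integral {0..1} (\<lambda>t. ?L (\<theta> j) t + ?L (pi - \<theta> j) t))"
    using int by (intro integral_sum integrable_add) auto
  also have "\<dots> = (\<Sum>j<m. log_quad_integral (\<theta> j) + log_quad_integral (pi - \<theta> j))"
    unfolding log_quad_integral_def using int by (intro sum.cong refl integral_add) auto
  finally show ?thesis by (simp add: \<theta>_def)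
qed

text \<open>
  The parameter \<open>x\<close> is kept apart from the number of summands so that the formula can be proved by induction; it is
  used with \<open>x = k\<close>.
\<close>

lemma sum_odd_times_reflected_odd:
  fixes x :: real
  shows "(\<Sum>j<k. (2 * real j + 1) * (2 * x - (2 * real j + 1))) =
           2 * x * (real k)\<^sup>2 - real k * (4 * (real k)\<^sup>2 - 1) / 3"
  by (induction k) (simp_all add: field_simps power2_eq_square)

lemma sum_angle_times_supplement:
  assumes "m > 0"
  shows "(\<Sum>j<m. pi * (2 * real j + 1) / (2 * real m) * (pi - pi * (2 * real j + 1) / (2 * real m))) =
           pi\<^sup>2 * (2 * (real m)\<^sup>2 + 1) / (12 * real m)"
proof -
  have "pi * (2 * real j + 1) / (2 * real m) * (pi - pi * (2 * real j + 1) / (2 * real m)) =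
          pi\<^sup>2 / (4 * (real m)\<^sup>2) * ((2 * real j + 1) * (2 * real m - (2 * real j + 1)))" for j
    using assms by (simp add: field_simps power2_eq_square)
  then have "(\<Sum>j<m. pi * (2 * real j + 1) / (2 * real m) * (pi - pi * (2 * real j + 1) / (2 * real m))) =
      pi\<^sup>2 / (4 * (real m)\<^sup>2) * (2 * real m * (real m)\<^sup>2 - real m * (4 * (real m)\<^sup>2 - 1) / 3)"
    by (simp only: sum_odd_times_reflected_odd flip: sum_distrib_left)
  also have "\<dots> = pi\<^sup>2 * (2 * (real m)\<^sup>2 + 1) / (12 * real m)"
    using assms by (simp add: field_simps power2_eq_square)
  finally show ?thesis .
qed

lemma integral_ln_one_plus_even_power:
  assumes "m > 0"
  shows "integral {0..1} (\<lambda>t::real. ln (1 + t ^ (2 * m)) / (1 + t)) =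
           pi\<^sup>2 / 48 * (1 / real m - 2 * real m) + real m * (ln 2)\<^sup>2
             - (\<Sum>j = 0..<m. ln (sin (pi * (2 * real j + 1) / (4 * real m)))
                             * ln (cos (pi * (2 * real j + 1) / (4 * real m))))"
proof -
  define S where "S = (\<Sum>j<m. ln (sin (pi * (2 * real j + 1) / (4 * real m)))
                             * ln (cos (pi * (2 * real j + 1) / (4 * real m))))"
  define \<theta> where "\<theta> j = pi * (2 * real j + 1) / (2 * real m)" for j
  have half: "\<theta> j / 2 = pi * (2 * real j + 1) / (4 * real m)" for j
    by (simp add: \<theta>_def)
  have "2 * integral {0..1} (\<lambda>t::real. ln (1 + t ^ (2 * m)) / (1 + t)) =
          (\<Sum>j<m. log_quad_integral (\<theta> j) + log_quad_integral (pi - \<theta> j))"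
    using twice_integral_as_log_quad_sum[OF assms] by (simp add: \<theta>_def)
  also have "\<dots> = (\<Sum>j<m. \<theta> j * (pi - \<theta> j) / 2 - 2 * (ln (sin (\<theta> j / 2)) * ln (cos (\<theta> j / 2)))
                        + (2 * (ln 2)\<^sup>2 - pi\<^sup>2 / 6))"
  proof (intro sum.cong refl)
    fix j assume "j \<in> {..<m}"
    then have "0 < \<theta> j" "\<theta> j < pi"
      unfolding \<theta>_def using odd_multiple_angle_bounds[of j m] by auto
    from log_quad_integral_reflection[OF this]
    show "log_quad_integral (\<theta> j) + log_quad_integral (pi - \<theta> j) =
            \<theta> j * (pi - \<theta> j) / 2 - 2 * (ln (sin (\<theta> j / 2)) * ln (cos (\<theta> j / 2)))
              + (2 * (ln 2)\<^sup>2 - pi\<^sup>2 / 6)" by simp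
  qed
  also have "\<dots> = (\<Sum>j<m. \<theta> j * (pi - \<theta> j)) / 2 - 2 * S + real m * (2 * (ln 2)\<^sup>2 - pi\<^sup>2 / 6)"
    unfolding half S_def
    by (simp add: sum.distrib sum_subtractf flip: sum_divide_distrib sum_distrib_left)
  also have "(\<Sum>j<m. \<theta> j * (pi - \<theta> j)) = pi\<^sup>2 * (2 * (real m)\<^sup>2 + 1) / (12 * real m)"
    unfolding \<theta>_def by (rule sum_angle_times_supplement[OF assms])
  also have "pi\<^sup>2 * (2 * (real m)\<^sup>2 + 1) / (12 * real m) = 4 * (pi\<^sup>2 / 48 * (1 / real m + 2 * real m))"
    using assms by (simp add: field_simps power2_eq_square)
  also have "4 * (pi\<^sup>2 / 48 * (1 / real m + 2 * real m)) / 2 - 2 * S + real m * (2 * (ln 2)\<^sup>2 - pi\<^sup>2 / 6) =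
      2 * (pi\<^sup>2 / 48 * (1 / real m - 2 * real m) + real m * (ln 2)\<^sup>2 - S)"
    by (simp add: algebra_simps diff_divide_distrib add_divide_distrib)
  finally show ?thesis
    unfolding S_def atLeast0LessThan by (simp only: mult_cancel_left) simp
qed

section \<open>Real arguments and reciprocal arguments\<close>

text \<open>
  For \<open>t \<ge> 0\<close> and real \<open>x\<close> the arguments of the principal branches are nonnegative reals, so the complex integrand is
  the embedded real one.
\<close>

lemma J_of_real:
  assumes "x > 0"
  shows "J (of_real x) = of_real (integral {0..1} (\<lambda>t. ln (1 + t powr x) / (1 + t)))"
proof -
  have cont: "continuous_on {0..1} (\<lambda>t. ln (1 + t powr x) / (1 + t))"
    using assms by (intro continuous_intros continuous_on_powr')
      (auto simp: add_nonneg_eq_0_iff)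
  have "(complex_of_real \<circ> (\<lambda>t. ln (1 + t powr x) / (1 + t)) has_integral
          of_real (integral {0..1} (\<lambda>t. ln (1 + t powr x) / (1 + t)))) {0..1}"
    by (intro has_integral_linear integrable_integral integrable_continuous_real cont
          bounded_linear_of_real)
  then have "((\<lambda>t. ln (1 + complex_of_real t powr of_real x) / (1 + of_real t)) has_integral
          of_real (integral {0..1} (\<lambda>t. ln (1 + t powr x) / (1 + t)))) {0..1}"
  proof (rule has_integral_eq[rotated])
    fix t :: real assume "t \<in> {0..1}"
    then have t: "t \<ge> 0" by simp
    have "ln (1 + complex_of_real t powr of_real x) = of_real (ln (1 + t powr x))"
      using Ln_of_real[of "1 + t powr x"] by (simp add: powr_of_real[OF t] add_pos_nonneg)
    then show "(complex_of_real \<circ> (\<lambda>t. ln (1 + t powr x) / (1 + t))) t =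
        ln (1 + complex_of_real t powr of_real x) / (1 + of_real t)" by simp
  qed
  then show ?thesis by (simp add: J_def integral_unique)
qed

lemma J_of_nat:
  assumes "n > 0"
  shows "J (of_nat n) = of_real (integral {0..1} (\<lambda>t. ln (1 + t ^ n) / (1 + t)))"
proof -
  have "integral {0..1} (\<lambda>t. ln (1 + t powr real n) / (1 + t)) =
          integral {0..1} (\<lambda>t. ln (1 + t ^ n) / (1 + t))"
    using assms by (intro integral_cong) (auto simp: powr_realpow')
  then show ?thesis using J_of_real[of "real n"] assms by simp
qed

text \<open>
  The substitution \<open>t = s\<^sup>n\<close> turns the left-hand integrand into \<open>ln (1 + s)\<close> times the derivative of
  \<open>ln (1 + s\<^sup>n)\<close>; integration by parts leaves the boundary value \<open>(ln 2)\<^sup>2\<close> and the integral for \<open>n\<close>.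
\<close>

lemma J_reciprocal:
  assumes n: "n > 0"
  shows "J (1 / of_nat n) = of_real ((ln 2)\<^sup>2) - J (of_nat n)"
proof -
  let ?f = "\<lambda>t. ln (1 + t powr (1 / real n)) / (1 + t)"
  let ?g = "\<lambda>s::real. ln (1 + s ^ n) / (1 + s)"
  have "((\<lambda>s. (real n * s ^ (n - 1)) *\<^sub>R ?f (s ^ n)) has_integral integral {0 ^ n..1 ^ n} ?f) {0..1}"
  proof (rule has_integral_substitution)
    show "continuous_on {0..1} ?f"
      using n by (intro continuous_intros continuous_on_powr') (auto simp: add_nonneg_eq_0_iff)
    show "(\<lambda>s::real. s ^ n) ` {0..1} \<subseteq> {0..1}" by (auto simp: power_le_one)
  qed (use n in \<open>auto intro!: derivative_eq_intros simp: zero_power\<close>)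
  then have "((\<lambda>s. (real n * s ^ (n - 1)) *\<^sub>R ?f (s ^ n)) has_integral integral {0..1} ?f) {0..1}"
    using n by (simp add: zero_power)
  then have A: "((\<lambda>s. ln (1 + s) * (real n * s ^ (n - 1) / (1 + s ^ n))) has_integral
                integral {0..1} ?f) {0..1}"
  proof (rule has_integral_eq[rotated])
    fix s :: real assume s: "s \<in> {0..1}"
    have "(s ^ n) powr (1 / real n) = s"
    proof (cases "s = 0")
      case False
      then show ?thesis using s n by (simp add: powr_realpow [symmetric] powr_powr)
    qed (use n in simp)
    then show "(real n * s ^ (n - 1)) *\<^sub>R ?f (s ^ n) =
                 ln (1 + s) * (real n * s ^ (n - 1) / (1 + s ^ n))" by simp
  qed
  have "((\<lambda>s. ?g s + ln (1 + s) * (real n * s ^ (n - 1) / (1 + s ^ n))) has_integral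
          ln (1 + 1) * ln (1 + 1 ^ n) - ln (1 + 0) * ln (1 + 0 ^ n)) {0..1}"
  proof (rule fundamental_theorem_of_calculus)
    fix s :: real assume s: "s \<in> {0..1}"
    then have "s ^ n \<ge> 0" by simp
    then have "1 + s ^ n > 0" by linarith
    then have "((\<lambda>s. ln (1 + s) * ln (1 + s ^ n)) has_real_derivative
           ?g s + ln (1 + s) * (real n * s ^ (n - 1) / (1 + s ^ n))) (at s within {0..1})"
      using s by (auto intro!: derivative_eq_intros simp: divide_inverse algebra_simps)
    then show "((\<lambda>s. ln (1 + s) * ln (1 + s ^ n)) has_vector_derivative
           ?g s + ln (1 + s) * (real n * s ^ (n - 1) / (1 + s ^ n))) (at s within {0..1})"
      by (simp add: has_real_derivative_iff_has_vector_derivative)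
  qed simp
  from has_integral_diff[OF this A]
  have "(?g has_integral (ln 2)\<^sup>2 - integral {0..1} ?f) {0..1}"
    using n by (simp add: power2_eq_square)
  then have "integral {0..1} ?g = (ln 2)\<^sup>2 - integral {0..1} ?f"
    by (rule integral_unique)
  then show ?thesis using J_of_real[of "1 / real n"] J_of_nat[OF n] n by simp
qed

theorem corollary3p6:
  fixes m :: nat
  assumes "m > 0"
  shows "J (2 * of_nat m) = complex_of_real
           (pi\<^sup>2 / 48 * (1 / real m - 2 * real m) + real m * (ln 2)\<^sup>2
             - (\<Sum>j = 0..<m. ln (sin (pi * (2 * real j + 1) / (4 * real m)))
                             * ln (cos (pi * (2 * real j + 1) / (4 * real m)))))
    \<and> J (1 / (2 * of_nat m)) = complex_of_real
           (pi\<^sup>2 / 48 * (2 * real m - 1 / real m) + (1 - real m) * (ln 2)\<^sup>2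
             + (\<Sum>j = 0..<m. ln (sin (pi * (2 * real j + 1) / (4 * real m)))
                             * ln (cos (pi * (2 * real j + 1) / (4 * real m)))))"
    (is "J ?n = complex_of_real ?A \<and> J (1 / ?n) = complex_of_real ?B")
proof
  have pos: "2 * m > 0" using assms by simp
  have n: "?n = of_nat (2 * m)" by simp
  show A: "J ?n = complex_of_real ?A"
    unfolding n J_of_nat[OF pos] integral_ln_one_plus_even_power[OF assms] ..
  have "J (1 / ?n) = complex_of_real ((ln 2)\<^sup>2) - J ?n"
    using J_reciprocal[OF pos] by (simp only: n)
  also have "\<dots> = complex_of_real ((ln 2)\<^sup>2 - ?A)"
    by (simp only: A of_real_diff)
  also have "(ln 2)\<^sup>2 - ?A = ?B"
    by (simp add: algebra_simps diff_divide_distrib)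
  finally show "J (1 / ?n) = complex_of_real ?B" .
qed

end
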